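(* Let $n=3$. A matrix $M\in\mathcal{M}_P$ minimizes $\mathrm{Vol}_1(\gamma_{M^{-1}})$ over $\mathcal{M}_P$ if and only if it is of the form $$M=k\begin{pmatrix}1&r&\frac{q^2}{3}+r^2\\ r&\frac{q^2}{3}+r^2&r(q^2+r^2)\\ \frac{q^2}{3}+r^2&r(q^2+r^2)&(q^2+r^2)^2\end{pmatrix}$$ for some real $q\neq0$, $r\in\mathbb{R}$ and $k>0$.
   Context: Let $f_P(x)=(1,x,x^2)^\top$ and $g_P(x)=f_P'(x)=(0,1,2x)^\top$. For a positive definite $3\times3$ matrix $\Sigma$, $$\mathrm{Vol}_1(\gamma_\Sigma)=2\int_{-\infty}^{\infty}\frac{\sqrt{(f_P(x)^\top\Sigma f_P(x))(g_P(x)^\top\Sigma g_P(x))-(f_P(x)^\top\Sigma g_P(x))^2}}{f_P(x)^\top\Sigma f_P(x)}\,dx .$$ $\mathcal{M}_P$ is the set of all positive definite $3\times3$ matrices of the form $\int_{\mathbb{R}} f_P(x)f_P(x)^\top\,d\rho(x)$ with $\rho$ a nonnegative finite measure on $\mathbb{R}$ for which the integral exists (equivalently, the set of positive definite $3\times 3$ Hankel matrices). *)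

theory Defs
  imports "HOL-Probability.Sinc_Integral"
begin

definition f_P :: "real \<Rightarrow> real^3" where
  "f_P x = vector [1, x, x^2]"

definition g_P :: "real \<Rightarrow> real^3" where
  "g_P x = vector [0, 1, 2 * x]"

lemma f_P_has_vector_derivative: "(f_P has_vector_derivative g_P x) (at x)"
  unfolding has_vector_derivative_def
  by (subst has_derivative_componentwise_within)
     (auto simp: Basis_vec_def inner_axis f_P_def g_P_def forall_3 intro!: derivative_eq_intros)

definition pos_def_matrix :: "real^'n^'n \<Rightarrow> bool" where
  "pos_def_matrix A \<longleftrightarrow> transpose A = A \<and> (\<forall>v. v \<noteq> 0 \<longrightarrow> 0 < v \<bullet> (A *v v))"

definition outer_product :: "real^'n \<Rightarrow> real^'m \<Rightarrow> real^'m^'n" where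
  "outer_product u v = (\<chi> i j. u $ i * v $ j)"

definition speed_P :: "real^3^3 \<Rightarrow> real \<Rightarrow> real" where
  "speed_P \<Sigma> x =
     sqrt ((f_P x \<bullet> (\<Sigma> *v f_P x)) * (g_P x \<bullet> (\<Sigma> *v g_P x)) - (f_P x \<bullet> (\<Sigma> *v g_P x))^2)
       / (f_P x \<bullet> (\<Sigma> *v f_P x))"

definition Vol1 :: "real^3^3 \<Rightarrow> real" where
  "Vol1 \<Sigma> = 2 * (LINT x|lborel. speed_P \<Sigma> x)"

lemma pos_def_matrix_coercive:
  fixes A :: "real^'n^'n"
  assumes "pos_def_matrix A"
  obtains c where "c > 0" "\<And>v. v \<bullet> (A *v v) \<ge> c * (norm v)^2"
proof -
  have cont: "continuous_on (sphere 0 1) (\<lambda>v. v \<bullet> (A *v v))"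
    by (intro continuous_intros matrix_vector_mult_linear_continuous_on)
  have "sphere (0::real^'n) 1 \<noteq> {}"
    by (auto intro: exI[of _ "axis undefined 1"] simp: norm_axis_1)
  then obtain u :: "real^'n" where u: "u \<in> sphere 0 1"
    and min: "\<And>v. v \<in> sphere 0 1 \<Longrightarrow> u \<bullet> (A *v u) \<le> v \<bullet> (A *v v)"
    using continuous_attains_inf[OF compact_sphere _ cont] by blast
  define c where "c = u \<bullet> (A *v u)"
  have "u \<noteq> 0" using u by auto
  then have "c > 0" using assms by (auto simp: c_def pos_def_matrix_def)
  moreover have "v \<bullet> (A *v v) \<ge> c * (norm v)^2" for v
  proof (cases "v = 0")
    case False
    define w where "w = (1 / norm v) *\<^sub>R v"
    have "w \<in> sphere 0 1" using False by (simp add: w_def)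
    then have "c \<le> w \<bullet> (A *v w)" using min by (simp add: c_def)
    also have "\<dots> = (v \<bullet> (A *v v)) / (norm v)^2"
      by (simp add: w_def matrix_vector_mult_scaleR power2_eq_square)
    finally show ?thesis using False by (simp add: field_simps)
  qed simp
  ultimately show ?thesis using that by blast
qed

text \<open>The Bochner integral of a non-integrable function is 0 by convention; this does not occur
  in \<^const>\<open>Vol1\<close> when \<open>\<Sigma>\<close> is positive definite.\<close>

lemma integrable_speed_P:
  assumes "pos_def_matrix \<Sigma>"
  shows "integrable lborel (speed_P \<Sigma>)"
proof -
  define s where "s i j = \<Sigma> $ i $ j" for i j :: 3
  have sym: "s i j = s j i" for i j
  proof -
    have "transpose \<Sigma> $ i $ j = \<Sigma> $ i $ j"
      using assms by (simp add: pos_def_matrix_def)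
    then show ?thesis by (simp add: transpose_def s_def)
  qed
  define a where "a x = f_P x \<bullet> (\<Sigma> *v f_P x)" for x
  define G where "G x = a x * (g_P x \<bullet> (\<Sigma> *v g_P x)) - (f_P x \<bullet> (\<Sigma> *v g_P x))^2" for x
  have a_eq: "a x = s 1 1 + 2 * s 1 2 * x + (s 2 2 + 2 * s 1 3) * x^2 + 2 * s 2 3 * x^3 + s 3 3 * x^4"
    for x
    unfolding a_def f_P_def inner_vec_def matrix_vector_mult_def sum_3
    by (simp add: s_def[symmetric] sym[of 2 1] sym[of 3 1] sym[of 3 2] power2_eq_square power3_eq_cube
      power4_eq_xxxx algebra_simps)
  define c0 where "c0 = s 1 1 * s 2 2 - (s 1 2)^2"
  define c1 where "c1 = 4 * (s 1 1 * s 2 3 - s 1 2 * s 1 3)"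
  define c2 where "c2 = 4 * (s 1 1 * s 3 3 - (s 1 3)^2) + 2 * (s 1 2 * s 2 3 - s 1 3 * s 2 2)"
  define c3 where "c3 = 4 * (s 1 2 * s 3 3 - s 1 3 * s 2 3)"
  define c4 where "c4 = s 2 2 * s 3 3 - (s 2 3)^2"
  have G_eq: "G x = c0 + c1 * x + c2 * x^2 + c3 * x^3 + c4 * x^4" for x
    unfolding G_def a_eq f_P_def g_P_def inner_vec_def matrix_vector_mult_def sum_3
      c0_def c1_def c2_def c3_def c4_def
    by (simp add: s_def[symmetric] sym[of 2 1] sym[of 3 1] sym[of 3 2] power2_eq_square power3_eq_cube
      power4_eq_xxxx algebra_simps)
  obtain c where c: "c > 0" "\<And>v. v \<bullet> (\<Sigma> *v v) \<ge> c * (norm v)^2"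
    by (rule pos_def_matrix_coercive[OF assms]) blast
  have a_ge: "a x \<ge> c / 2 * (1 + x^2)^2" for x
  proof -
    have "(norm (f_P x))^2 = 1 + x^2 + x^4"
      unfolding power2_norm_eq_inner by (simp add: f_P_def inner_vec_def sum_3 power4_eq_xxxx power2_eq_square)
    moreover have "(1 + x^2)^2 / 2 \<le> 1 + x^2 + x^4"
    proof -
      have "(1 + x^2)^2 = 1 + 2 * x^2 + x^4" by algebra
      moreover have "0 \<le> x^4" by simp
      ultimately show ?thesis by linarith
    qed
    ultimately have "c * ((1 + x^2)^2 / 2) \<le> c * (norm (f_P x))^2"
      using c(1) by (intro mult_left_mono) auto
    with c(2)[of "f_P x"] show ?thesis by (simp add: a_def)
  qed
  have a_pos: "a x > 0" for x
  proof -
    have "1 + x^2 > 0" by (simp add: add_pos_nonneg)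
    then have "c / 2 * (1 + x^2)^2 > 0" using c(1) by simp
    with a_ge[of x] show ?thesis by linarith
  qed
  define K where "K = \<bar>c0\<bar> + \<bar>c1\<bar> + \<bar>c2\<bar> + \<bar>c3\<bar> + \<bar>c4\<bar>"
  have G_le: "\<bar>G x\<bar> \<le> K * (1 + x^2)^2" for x
  proof -
    have sq: "(1 + x^2)^2 = 1 + 2 * x^2 + x^4" by algebra
    have x1: "\<bar>x\<bar> \<le> 1 + x^2"
      using zero_le_power2[of "\<bar>x\<bar> - 1"] by (simp add: power2_diff)
    have "\<bar>x\<bar>^3 = \<bar>x\<bar> * x^2" by (simp add: power3_eq_cube power2_eq_square abs_mult)
    also have "\<dots> \<le> (1 + x^2) * x^2" using x1 by (intro mult_right_mono) auto
    also have "\<dots> = x^2 + x^4" by algebra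
    finally have x3: "\<bar>x\<bar>^3 \<le> x^2 + x^4" .
    have p: "0 \<le> x^2" "0 \<le> x^4" by auto
    have "\<bar>G x\<bar> \<le> \<bar>c0\<bar> * 1 + \<bar>c1\<bar> * \<bar>x\<bar> + \<bar>c2\<bar> * x^2 + \<bar>c3\<bar> * \<bar>x\<bar>^3 + \<bar>c4\<bar> * x^4"
      unfolding G_eq using p
      by (intro order_trans[OF abs_triangle_ineq] add_mono) (auto simp: abs_mult power_abs)
    also have "\<dots> \<le> \<bar>c0\<bar> * (1 + x^2)^2 + \<bar>c1\<bar> * (1 + x^2)^2 + \<bar>c2\<bar> * (1 + x^2)^2
        + \<bar>c3\<bar> * (1 + x^2)^2 + \<bar>c4\<bar> * (1 + x^2)^2"
      unfolding sq using p x1 x3 by (intro add_mono mult_left_mono) linarith+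
    finally show ?thesis by (simp add: K_def algebra_simps)
  qed
  have bound: "norm (speed_P \<Sigma> x) \<le> norm (2 * sqrt K / c * inverse (1 + x^2))" for x
  proof -
    define t where "t = 1 + x^2"
    have t: "t > 0" by (simp add: add_pos_nonneg t_def)
    have K: "K \<ge> 0" by (simp add: K_def)
    have sqrt_abs: "\<bar>sqrt y\<bar> = sqrt \<bar>y\<bar>" for y
      by (simp add: abs_if real_sqrt_minus)
    have "norm (speed_P \<Sigma> x) = sqrt \<bar>G x\<bar> / a x"
      using a_pos[of x] by (simp add: speed_P_def a_def[symmetric] G_def abs_divide sqrt_abs)
    also have "\<dots> \<le> sqrt (K * t^2) / (c / 2 * t^2)"
      using G_le[of x] a_ge[of x] c(1) t a_pos[of x]
      by (intro frac_le) (auto simp: t_def)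
    also have "\<dots> = 2 * sqrt K / c * inverse t"
      using t c(1) by (simp add: real_sqrt_mult field_simps power2_eq_square)
    also have "\<dots> = norm (2 * sqrt K / c * inverse t)" using t c(1) K by simp
    finally show ?thesis by (simp add: t_def)
  qed
  have int: "integrable lborel (\<lambda>x::real. 2 * sqrt K / c * inverse (1 + x^2))"
    using integrable_inverse_1_plus_square
    by (intro integrable_mult_right) (simp add: set_integrable_def)
  have "speed_P \<Sigma> = (\<lambda>x. sqrt (G x) / a x)"
    by (simp add: fun_eq_iff speed_P_def a_def[symmetric] G_def)
  then have "continuous_on UNIV (speed_P \<Sigma>)"
    using a_pos unfolding G_eq a_eq
    by (auto intro!: continuous_intros simp: less_le)
  then have "speed_P \<Sigma> \<in> borel_measurable lborel"
    by (simp add: borel_measurable_continuous_onI)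
  with int bound show ?thesis
    by (auto intro: Bochner_Integration.integrable_bound)
qed

definition M_P :: "(real^3^3) set" where
  "M_P = {M. pos_def_matrix M \<and>
     (\<exists>\<rho>. sets \<rho> = sets borel \<and> finite_measure \<rho> \<and>
          integrable \<rho> (\<lambda>x. outer_product (f_P x) (f_P x)) \<and>
          M = (LINT x|\<rho>. outer_product (f_P x) (f_P x)))}"

end

theory Submission
  imports Defs "HOL-Real_Asymp.Real_Asymp"
begin

text \<open>The integrand is \<open>sqrt (D * Q x) / A x\<close>, where for \<open>M\<close> with entries \<open>m\<^sub>i\<^sub>+\<^sub>j\<close> the quartics are
  \<open>A x = f\<^sup>T adj(M) f\<close> and \<open>Q x = m\<^sub>4 - 4 m\<^sub>3 x + 6 m\<^sub>2 x\<^sup>2 - 4 m\<^sub>1 x\<^sup>3 + m\<^sub>0 x\<^sup>4\<close>, and \<open>D = det M\<close>.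
  By the intermediate value theorem some affine substitution \<open>x = b + a y\<close> brings the moments
  to a multiple of \<open>(3 - c, - d, 1 + c, d, 3 - c)\<close>. With \<open>y = tan (\<theta> / 2)\<close>,
  \<open>j = c cos 2\<theta> + d sin 2\<theta>\<close> and \<open>E = c\<^sup>2 + d\<^sup>2 < 1\<close> the integrand becomes
  \<open>sqrt (8 (1 - E)) sqrt (3 - j) / (3 - E + 2 j)\<close> against \<open>dy / (1 + y\<^sup>2)\<close>. Replacing the concave
  function \<open>sqrt (3 - j)\<close> by its chord over \<open>[- sqrt E, sqrt E]\<close> leaves an integral that is
  elementary, and gives a lower bound for the volume that exceeds the value at \<open>E = 0\<close>
  unless \<open>E = 0\<close>.\<close>

section \<open>Integrals over the circle\<close>

text \<open>\<open>cos2\<close> and \<open>sin2\<close> are \<open>cos 2\<theta>\<close> and \<open>sin 2\<theta>\<close> in terms of \<open>x = tan (\<theta> / 2)\<close>.\<close>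

definition cos2 :: "real \<Rightarrow> real" where
  "cos2 x = ((1 - x^2)^2 - 4 * x^2) / (1 + x^2)^2"

definition sin2 :: "real \<Rightarrow> real" where
  "sin2 x = 4 * x * (1 - x^2) / (1 + x^2)^2"

lemma one_plus_square_pos: "0 < 1 + (x::real)^2"
  by (simp add: add_pos_nonneg)

lemma cos2_sin2_squares: "(cos2 x)^2 + (sin2 x)^2 = 1"
proof -
  have "((1 - x^2)^2 - 4 * x^2)^2 + (4 * x * (1 - x^2))^2 = ((1 + x^2)^2)^2"
    by algebra
  then show ?thesis
    using one_plus_square_pos[of x]
    by (simp add: cos2_def sin2_def power_divide add_divide_distrib[symmetric])
qed

lemma cos2_has_derivative:
  "(cos2 has_real_derivative - 4 * sin2 x / (1 + x^2)) (at x)"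
proof -
  have w: "1 + x^2 \<noteq> 0" using one_plus_square_pos[of x] by simp
  show ?thesis
    unfolding cos2_def[abs_def] sin2_def
    by ((rule derivative_eq_intros refl | simp add: w)+, use w in \<open>simp add: divide_simps\<close>, algebra)
qed

lemma sin2_has_derivative:
  "(sin2 has_real_derivative 4 * cos2 x / (1 + x^2)) (at x)"
proof -
  have w: "1 + x^2 \<noteq> 0" using one_plus_square_pos[of x] by simp
  show ?thesis
    unfolding sin2_def[abs_def] cos2_def
    by ((rule derivative_eq_intros refl | simp add: w)+, use w in \<open>simp add: divide_simps\<close>, algebra)
qed

lemma cos2_tendsto: "(cos2 \<longlongrightarrow> 1) at_top" "(cos2 \<longlongrightarrow> 1) at_bot"
  unfolding cos2_def[abs_def] by real_asymp+

lemma sin2_tendsto: "(sin2 \<longlongrightarrow> 0) at_top" "(sin2 \<longlongrightarrow> 0) at_bot"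
  unfolding sin2_def[abs_def] by real_asymp+

text \<open>Cauchy-Schwarz for the unit vector \<open>(cos2 x, sin2 x)\<close>: the square of the
  left side and that of \<open>c * sin2 x - d * cos2 x\<close> add up to
  \<open>c^2 + d^2\<close>.\<close>

lemma cos2_sin2_bound: "\<bar>c * cos2 x + d * sin2 x\<bar> \<le> sqrt (c^2 + d^2)"
proof -
  have "(c * cos2 x + d * sin2 x)^2 + (c * sin2 x - d * cos2 x)^2
      = (c^2 + d^2) * ((cos2 x)^2 + (sin2 x)^2)" by algebra
  then have "(c * cos2 x + d * sin2 x)^2 \<le> c^2 + d^2"
    unfolding cos2_sin2_squares by (smt (verit) zero_le_power2)
  then show ?thesis
    by (metis real_sqrt_abs real_sqrt_le_iff)
qed

text \<open>Nonnegativity yields integrability along with the value, so the limits of an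
  antiderivative at both ends suffice.\<close>

lemma integral_FTC_UNIV_nonneg:
  fixes f F :: "real \<Rightarrow> real"
  assumes F: "\<And>x. (F has_real_derivative f x) (at x)"
    and f: "\<And>x. isCont f x" "\<And>x. 0 \<le> f x"
    and A: "(F \<longlongrightarrow> A) at_bot" and B: "(F \<longlongrightarrow> B) at_top"
  shows "has_bochner_integral lborel f (B - A)"
proof -
  have lims: "((F \<circ> real_of_ereal) \<longlongrightarrow> A) (at_right (-\<infinity>))"
    "((F \<circ> real_of_ereal) \<longlongrightarrow> B) (at_left \<infinity>)"
    using A B by (simp_all add: ereal_tendsto_simps)
  have "set_integrable lborel (einterval (-\<infinity>) \<infinity>) f" "(LBINT x=-\<infinity>..\<infinity>. f x) = B - A"
    by (rule interval_integral_FTC_nonneg[OF _ F f(1) _ lims]; simp add: f(2))+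
  then show ?thesis
    by (simp add: has_bochner_integral_iff set_integrable_def interval_lebesgue_integral_def
        set_lebesgue_integral_def einterval_def)
qed

text \<open>With \<open>e = sqrt (c^2 + d^2)\<close> the weight is at least
  \<open>3 - e^2 - 2 * e = (1 - e) * (3 + e)\<close>.\<close>

lemma cos2_sin2_weight_pos:
  assumes "c^2 + d^2 < 1"
  shows "0 < 3 - (c^2 + d^2) + 2 * (c * cos2 x + d * sin2 x)"
proof -
  define e where "e = sqrt (c^2 + d^2)"
  have "0 \<le> e" "e < 1" using assms by (auto simp: e_def)
  then have "0 < (1 - e) * (3 + e)" by simp
  also have "\<dots> = 3 - e^2 - 2 * e" by algebra
  finally have "2 * e < 3 - (c^2 + d^2)" by (simp add: e_def)
  then show ?thesis
    using cos2_sin2_bound[of c x d] by (simp add: e_def abs_le_iff)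
qed

text \<open>Under \<open>x = tan (\<theta> / 2)\<close> one has
  \<open>dx / (1 + x^2) = d\<theta> / 2\<close>, so this is the classical integral of
  \<open>1 / (P + 2 * sqrt E * cos \<phi>)\<close> over a period, where \<open>P = 3 - E\<close> and
  \<open>P^2 - 4 * E = (9 - E) * (1 - E)\<close>.\<close>

lemma has_bochner_integral_inverse_weight:
  fixes c d :: real
  defines "E \<equiv> c^2 + d^2"
  assumes E: "E < 1"
  shows "has_bochner_integral lborel
    (\<lambda>x. 1 / ((3 - E + 2 * (c * cos2 x + d * sin2 x)) * (1 + x^2)))
    (pi / sqrt ((9 - E) * (1 - E)))"
proof -
  define P where "P = 3 - E"
  define R where "R = sqrt ((9 - E) * (1 - E))"
  define j where "j x = c * cos2 x + d * sin2 x" for x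
  define l where "l x = c * sin2 x - d * cos2 x" for x
  have E0: "0 \<le> E" by (simp add: E_def)
  have R: "0 < R" using E by (simp add: R_def)
  have R2: "P^2 - R^2 = 4 * E"
  proof -
    have "0 \<le> (9 - E) * (1 - E)" using E by (intro mult_nonneg_nonneg) auto
    then have "R^2 = (9 - E) * (1 - E)" by (simp add: R_def)
    then show ?thesis unfolding P_def by algebra
  qed
  have jl: "(j x)^2 + (l x)^2 = E" for x
  proof -
    have "(j x)^2 + (l x)^2 = E * ((cos2 x)^2 + (sin2 x)^2)"
      unfolding j_def l_def E_def by algebra
    then show ?thesis by (simp add: cos2_sin2_squares)
  qed
  have dj: "(j has_real_derivative - 4 * l x / (1 + x^2)) (at x)" for x
    unfolding j_def[abs_def] l_def
    by (rule derivative_eq_intros cos2_has_derivative sin2_has_derivative refl)+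
      (simp add: algebra_simps diff_divide_distrib)
  have dl: "(l has_real_derivative 4 * j x / (1 + x^2)) (at x)" for x
    unfolding l_def[abs_def] j_def
    by (rule derivative_eq_intros cos2_has_derivative sin2_has_derivative refl)+
      (simp add: algebra_simps add_divide_distrib)
  have Pj: "0 < P + 2 * j x" for x
    using cos2_sin2_weight_pos E by (simp add: P_def j_def E_def)
  have PRj: "0 < P + R + 2 * j x" for x using Pj[of x] R by simp
  txt \<open>The obvious antiderivative, a multiple of the arctangent of a scaled \<open>tan (\<theta> - \<psi>)\<close>, has poles.
    Subtracting \<open>\<theta> - \<psi>\<close> inside and adding it outside gives this globally smooth branch.\<close>
  define F where "F x = (arctan x - arctan (2 * l x / (P + R + 2 * j x)) / 2) / R" for x
  have dF: "(F has_real_derivative 1 / ((P + 2 * j x) * (1 + x^2))) (at x)" for x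
  proof -
    define w where "w = 1 + x^2"
    define J where "J = j x"
    define L where "L = l x"
    define G where "G = P + R + 2 * J"
    have w: "w > 0" unfolding w_def by (rule one_plus_square_pos)
    have G: "G > 0" using PRj[of x] by (simp add: G_def J_def)
    have JL: "J^2 + L^2 = E" unfolding J_def L_def by (rule jl)
    have pos: "P + 2 * J > 0" using Pj[of x] by (simp add: J_def)
    have PR: "P + R > 0"
      using E E0 R by (simp add: P_def)
    define N where "N = G^2 + 4 * L^2"
    \<comment> \<open>The choice of \<open>R\<close> with \<open>P^2 - R^2 = 4 * E\<close> makes
      \<open>N\<close> factor, and the factor \<open>P + 2 * J\<close> is the wanted
      denominator.\<close>
    have N: "N = 2 * (P + R) * (P + 2 * J)"
    proof -
      have "N = (P + R)^2 + 4 * J * (P + R) + 4 * (J^2 + L^2)"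
        unfolding N_def G_def by algebra
      also have "\<dots> = (P + R)^2 + 4 * J * (P + R) + (P^2 - R^2)"
        by (simp add: JL R2)
      also have "\<dots> = 2 * (P + R) * (P + 2 * J)" by algebra
      finally show ?thesis .
    qed
    define q where "q = ((2 * (4 * J / w)) * G - 2 * L * (2 * (- 4 * L / w))) / (G * G)"
    have dq: "((\<lambda>x. 2 * l x / (P + R + 2 * j x)) has_real_derivative q) (at x)"
      by (rule derivative_eq_intros dj dl refl | use PRj[of x] in \<open>simp; fail\<close>)+
        (simp add: q_def J_def L_def G_def w_def)
    have "((\<lambda>x. arctan (2 * l x / (P + R + 2 * j x))) has_real_derivative
        inverse (1 + (2 * L / G)^2) * q) (at x)"
      using DERIV_chain2[OF DERIV_arctan dq] by (simp add: J_def L_def G_def)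
    from DERIV_cdivide[OF DERIV_diff[OF DERIV_arctan DERIV_cdivide[OF this, of 2]], of R]
    have "(F has_real_derivative
        (inverse w - inverse (1 + (2 * L / G)^2) * q / 2) / R) (at x)"
      unfolding F_def[abs_def] w_def .
    also have "(inverse w - inverse (1 + (2 * L / G)^2) * q / 2) / R
        = (1 - (4 * J * G + 8 * L^2) / N) / (w * R)"
    proof -
      have N0: "N > 0" using G by (simp add: N_def add_pos_nonneg)
      have "1 + (2 * L / G)^2 = N / (G * G)"
        using G by (simp add: N_def power_divide add_divide_distrib power2_eq_square)
      moreover have "q = (8 * J * G + 16 * L^2) / (w * (G * G))"
        using w G by (simp add: q_def field_simps power2_eq_square)
      ultimately have "inverse (1 + (2 * L / G)^2) * q = (8 * J * G + 16 * L^2) / (w * N)"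
        using w G N0 by simp
      then show ?thesis using N0 R w
        by (simp only:) (simp add: field_simps)
    qed
    also have "\<dots> = 1 / ((P + 2 * J) * w)"
    proof -
      have "N - (4 * J * G + 8 * L^2) = (P + R)^2 - 4 * (J^2 + L^2)"
        unfolding N_def G_def by algebra
      also have "\<dots> = (P + R)^2 - (P^2 - R^2)"
        by (simp add: JL R2)
      also have "\<dots> = 2 * (P + R) * R" by algebra
      finally have "N - (4 * J * G + 8 * L^2) = 2 * (P + R) * R" .
      then have "(1 - (4 * J * G + 8 * L^2) / N) = R / (P + 2 * J)"
        using PR pos by (simp add: divide_simps N)
      then show ?thesis using R w pos by simp
    qed
    finally show ?thesis by (simp add: w_def J_def)
  qed
  have cont: "isCont (\<lambda>x. 1 / ((P + 2 * j x) * (1 + x^2))) x" for x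
    using Pj[of x] one_plus_square_pos[of x] DERIV_isCont[OF dj]
    by (intro continuous_intros) auto
  \<comment> \<open>\<open>cos2\<close> and \<open>sin2\<close> have the same limits at both ends,
    so the second arctangent cancels and only \<open>arctan x\<close> contributes to the total
    increment of \<open>F\<close>.\<close>
  have lim: "((\<lambda>x. arctan (2 * l x / (P + R + 2 * j x)) / 2)
      \<longlongrightarrow> arctan (2 * (c * 0 - d * 1) / (P + R + 2 * (c * 1 + d * 0))) / 2) G"
    if "(cos2 \<longlongrightarrow> 1) G" "(sin2 \<longlongrightarrow> 0) G" for G
  proof -
    have "P + R + 2 * (c * 1 + d * 0) > 0"
      using PRj[of 0] by (simp add: j_def cos2_def sin2_def)
    then show ?thesis
      unfolding j_def l_def by (intro tendsto_intros that) auto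
  qed
  have "has_bochner_integral lborel (\<lambda>x. 1 / ((P + 2 * j x) * (1 + x^2)))
     ((pi / 2 - arctan (2 * (c * 0 - d * 1) / (P + R + 2 * (c * 1 + d * 0))) / 2) / R
     - (- (pi / 2) - arctan (2 * (c * 0 - d * 1) / (P + R + 2 * (c * 1 + d * 0))) / 2) / R)"
    by (rule integral_FTC_UNIV_nonneg[OF dF cont])
      (use Pj one_plus_square_pos R in \<open>auto simp: F_def[abs_def] less_imp_le intro!: tendsto_intros
        tendsto_arctan_at_top tendsto_arctan_at_bot lim[simplified] cos2_tendsto sin2_tendsto\<close>)
  then show ?thesis
    by (simp add: P_def R_def j_def diff_divide_distrib)
qed

corollary has_bochner_integral_inverse_1_plus_square:
  "has_bochner_integral lborel (\<lambda>x::real. 1 / (1 + x^2)) pi"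
proof -
  have "has_bochner_integral lborel (\<lambda>x::real. 3 * (1 / (3 * (1 + x^2)))) pi"
    using has_bochner_integral_mult_right[OF has_bochner_integral_inverse_weight[of 0 0], of 3]
    by (simp add: field_simps)
  moreover have "3 * (1 / (3 * (1 + x^2))) = 1 / (1 + x^2)" for x :: real
    by (simp del: distrib_left_numeral)
  ultimately show ?thesis by simp
qed

section \<open>The normalized volume integral and its strict lower bound\<close>

definition speed_normal :: "real \<Rightarrow> real \<Rightarrow> real \<Rightarrow> real" where
  "speed_normal c d x = sqrt (8 * (1 - (c^2 + d^2))) * sqrt (3 - (c * cos2 x + d * sin2 x))
     / ((3 - (c^2 + d^2) + 2 * (c * cos2 x + d * sin2 x)) * (1 + x^2))"

lemma integral_speed_normal_0: "(LINT x|lborel. speed_normal 0 0 x) = pi * sqrt (8 / 3)"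
proof -
  have "sqrt 8 * sqrt 3 / 3 = sqrt (8 / 3)"
    by (simp add: real_sqrt_divide field_simps)
  then have "speed_normal 0 0 = (\<lambda>x. sqrt (8 / 3) * (1 / (1 + x^2)))"
    by (simp add: speed_normal_def fun_eq_iff del: distrib_left_numeral)
  then show ?thesis
    using has_bochner_integral_mult_right[OF has_bochner_integral_inverse_1_plus_square, of "sqrt (8 / 3)"]
    by (simp add: has_bochner_integral_iff mult.commute)
qed

text \<open>The left side is the chord of \<open>sqrt (3 - j)\<close> over \<open>[- e, e]\<close>.
  With end values \<open>q \<le> y \<le> p\<close>, concavity becomes
  \<open>0 \<le> (y - q) * (p - y)\<close>.\<close>

lemma sqrt_chord:
  fixes j e :: real
  assumes "\<bar>j\<bar> \<le> e" "e \<le> 3"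
  shows "(3 + sqrt (9 - e^2) - j) / (sqrt (3 + e) + sqrt (3 - e)) \<le> sqrt (3 - j)"
proof -
  define p where "p = sqrt (3 + e)"
  define q where "q = sqrt (3 - e)"
  define y where "y = sqrt (3 - j)"
  have e: "0 \<le> e" "\<bar>j\<bar> \<le> 3" using assms by auto
  have pq: "p * q = sqrt (9 - e^2)"
    unfolding p_def q_def real_sqrt_mult[symmetric] by (simp add: algebra_simps power2_eq_square)
  have y2: "y^2 = 3 - j" using e by (simp add: y_def)
  have "q \<le> y" "y \<le> p" using assms by (auto simp: p_def q_def y_def)
  then have "0 \<le> (y - q) * (p - y)" by simp
  then have "y^2 + p * q \<le> y * (p + q)" by (simp add: algebra_simps power2_eq_square)
  moreover have "0 < p + q" using assms e by (auto simp: p_def q_def intro: add_pos_nonneg)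
  ultimately show ?thesis
    unfolding p_def[symmetric] q_def[symmetric] y_def[symmetric] pq[symmetric]
    by (simp add: y2 pos_divide_le_eq)
qed

text \<open>The chord makes the numerator affine in \<open>j\<close>; dividing by
  \<open>P + 2 * j\<close> then leaves a combination of two known integrals, and the claim reduces
  to an inequality between algebraic functions of \<open>E\<close>.\<close>

lemma integral_speed_normal_gt:
  assumes "c^2 + d^2 < 1" "c \<noteq> 0 \<or> d \<noteq> 0"
  shows "pi * sqrt (8 / 3) < (LINT x|lborel. speed_normal c d x)"
proof -
  define E where "E = c^2 + d^2"
  define e where "e = sqrt E"
  define P where "P = 3 - E"
  define t where "t = sqrt (9 - E)"
  define R where "R = t * sqrt (1 - E)"
  define B where "B = sqrt (3 + e) + sqrt (3 - e)"
  define K where "K = 3 + t"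
  define j where "j x = c * cos2 x + d * sin2 x" for x
  define W where "W x = 1 / ((P + 2 * j x) * (1 + x^2))" for x :: real
  have E: "0 < E" "E < 1" using assms by (auto simp: E_def sum_power2_gt_zero_iff)
  have e: "0 \<le> e" "e < 1" "e^2 = E" using E by (auto simp: e_def)
  have t: "0 < t" "t < 3" "t^2 = 9 - E"
  proof -
    have "t < sqrt (3^2)" unfolding t_def using E by (intro real_sqrt_less_mono) simp
    then show "t < 3" by simp
  qed (use E in \<open>auto simp: t_def\<close>)
  have R: "0 < R" using E t by (simp add: R_def)
  have RP: "R \<le> P"
  proof (rule power2_le_imp_le)
    have "R^2 = (9 - E) * (1 - E)" using E t by (simp add: R_def power_mult_distrib)
    also have "\<dots> = P^2 - 4 * E" unfolding P_def by algebra
    finally show "R^2 \<le> P^2" using E by simp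
  qed (use E in \<open>simp add: P_def\<close>)
  have B: "0 < B" using e by (auto simp: B_def intro: add_pos_nonneg)
  have B2: "B^2 = 2 * K"
  proof -
    have "B^2 = (sqrt (3 + e))^2 + (sqrt (3 - e))^2 + 2 * (sqrt (3 + e) * sqrt (3 - e))"
      unfolding B_def by algebra
    also have "sqrt (3 + e) * sqrt (3 - e) = t"
      unfolding t_def real_sqrt_mult[symmetric] e(3)[symmetric]
      by (simp add: algebra_simps power2_eq_square)
    finally show ?thesis using e by (simp add: K_def)
  qed
  have W: "has_bochner_integral lborel W (pi / R)"
    using has_bochner_integral_inverse_weight[of c d] assms(1)
    by (simp add: W_def[abs_def] P_def j_def R_def t_def E_def real_sqrt_mult)
  have Pj: "0 < P + 2 * j x" for x
    using cos2_sin2_weight_pos[OF assms(1)] by (simp add: P_def E_def j_def)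
  have W0: "0 < W x" for x
    using Pj[of x] one_plus_square_pos[of x] by (simp add: W_def)
  have je: "\<bar>j x\<bar> \<le> e" for x
    unfolding j_def e_def E_def by (rule cos2_sin2_bound)
  have speed: "speed_normal c d x = sqrt (8 * (1 - E)) * (sqrt (3 - j x) * W x)" for x
    by (simp add: speed_normal_def W_def E_def P_def j_def)
  have cont: "continuous_on UNIV j"
    unfolding j_def
    using DERIV_isCont[OF cos2_has_derivative] DERIV_isCont[OF sin2_has_derivative]
    by (intro continuous_intros) (auto simp: continuous_on_eq_continuous_at)
  have int: "integrable lborel (\<lambda>x. sqrt (3 - j x) * W x)"
  proof (rule Bochner_Integration.integrable_bound)
    show "integrable lborel (\<lambda>x. 2 * W x)"
      using W by (simp add: has_bochner_integral_iff)
    have "sqrt (3 - j x) \<le> 2" for x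
      using je[of x] e by (intro real_le_lsqrt) auto
    then show "AE x in lborel. norm (sqrt (3 - j x) * W x) \<le> norm (2 * W x)"
      using je e W0 by (auto simp: abs_mult less_imp_le intro!: AE_I2 mult_right_mono)
        (smt (verit) je real_sqrt_ge_zero)
    have "W \<in> borel_measurable lborel"
      using W by (auto simp: has_bochner_integral_iff)
    moreover have "(\<lambda>x. sqrt (3 - j x)) \<in> borel_measurable lborel"
      using cont by (auto intro!: borel_measurable_continuous_onI continuous_intros)
    ultimately show "(\<lambda>x. sqrt (3 - j x) * W x) \<in> borel_measurable lborel"
      by measurable
  qed
  \<comment> \<open>This is \<open>(K - j x) / B * W x\<close>, with \<open>j\<close> eliminated
    through \<open>(P + 2 * j x) * W x = 1 / (1 + x^2)\<close>.\<close>
  define lower where "lower x = ((K + P / 2) * W x - 1 / 2 * (1 / (1 + x^2))) / B" for x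
  have lower: "has_bochner_integral lborel lower (((K + P / 2) * (pi / R) - 1 / 2 * pi) / B)"
    unfolding lower_def
    by (intro has_bochner_integral_divide has_bochner_integral_diff has_bochner_integral_mult_right
      has_bochner_integral_inverse_1_plus_square W)
  have le: "lower x \<le> sqrt (3 - j x) * W x" for x
  proof -
    have "1 / (1 + x^2) = (P + 2 * j x) * W x"
      using Pj[of x] by (simp add: W_def)
    then have "lower x = (K - j x) / B * W x"
      by (simp only: lower_def) (simp add: algebra_simps)
    also have "\<dots> \<le> sqrt (3 - j x) * W x"
      using sqrt_chord[OF je, of x] e W0[of x]
      by (intro mult_right_mono) (auto simp: K_def t_def B_def less_imp_le)
    finally show ?thesis .
  qed
  \<comment> \<open>The difference of the squares is \<open>K * (3 - t) * (2 * t + 3)\<close>.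
    Strictness comes from \<open>t < 3\<close>, that is, from \<open>E > 0\<close>.\<close>
  have "t * B < K * sqrt 3"
  proof (rule power2_less_imp_less)
    have "0 < (3 - t) * (2 * t + 3) * K" using t by (simp add: K_def)
    also have "\<dots> = (K * sqrt 3)^2 - t^2 * (2 * K)"
      unfolding power_mult_distrib by (simp add: K_def) algebra
    also have "t^2 * (2 * K) = (t * B)^2" by (simp add: power_mult_distrib B2)
    finally show "(t * B)^2 < (K * sqrt 3)^2" by simp
  qed (use t in \<open>simp add: K_def\<close>)
  then have "1 < K * sqrt 3 / (t * B)" using t B by simp
  then have "pi * sqrt (8 / 3) * 1 < pi * sqrt (8 / 3) * (K * sqrt 3 / (t * B))"
    by (intro mult_strict_left_mono) auto
  \<comment> \<open>The factor \<open>sqrt (1 - E)\<close> cancels against the one in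
    \<open>R\<close>.\<close>
  also have "\<dots> = sqrt (8 * (1 - E)) * (K * (pi / R) / B)"
    unfolding R_def real_sqrt_mult real_sqrt_divide
    using E t B by (simp add: field_simps)
  \<comment> \<open>Since \<open>R \<le> P\<close>, the term \<open>P / 2 * (pi / R)\<close>
    outweighs the subtracted \<open>pi / 2\<close>.\<close>
  also have "\<dots> \<le> sqrt (8 * (1 - E)) * (((K + P / 2) * (pi / R) - 1 / 2 * pi) / B)"
  proof -
    have "pi \<le> P * (pi / R)" using RP R by (simp add: field_simps)
    then show ?thesis using E B
      by (intro mult_left_mono divide_right_mono) (auto simp: algebra_simps)
  qed
  also have "\<dots> \<le> sqrt (8 * (1 - E)) * (LINT x|lborel. sqrt (3 - j x) * W x)"
    using lower int le E unfolding has_bochner_integral_integral_eq[OF lower, symmetric]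
    by (intro mult_left_mono integral_mono) (auto simp: has_bochner_integral_iff)
  also have "\<dots> = (LINT x|lborel. speed_normal c d x)"
    by (simp add: speed)
  finally show ?thesis by simp
qed

section \<open>Hankel matrices and affine substitutions\<close>

definition hankel :: "(nat \<Rightarrow> real) \<Rightarrow> real^3^3" where
  "hankel m = vector [vector [m 0, m 1, m 2], vector [m 1, m 2, m 3], vector [m 2, m 3, m 4]]"

definition hankel_det :: "(nat \<Rightarrow> real) \<Rightarrow> real" where
  "hankel_det m = m 0 * m 2 * m 4 + 2 * m 1 * m 2 * m 3 - m 0 * (m 3)^2 - (m 1)^2 * m 4 - (m 2)^3"

definition hankel_adj :: "(nat \<Rightarrow> real) \<Rightarrow> real^3^3" where
  "hankel_adj m = vector [
     vector [m 2 * m 4 - (m 3)^2, m 2 * m 3 - m 1 * m 4, m 1 * m 3 - (m 2)^2],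
     vector [m 2 * m 3 - m 1 * m 4, m 0 * m 4 - (m 2)^2, m 1 * m 2 - m 0 * m 3],
     vector [m 1 * m 3 - (m 2)^2, m 1 * m 2 - m 0 * m 3, m 0 * m 2 - (m 1)^2]]"

text \<open>If the \<open>m i\<close> are the moments of \<open>\<rho>\<close>, this is \<open>\<integral> (x - t)\<^sup>4 d\<rho>(t)\<close>.\<close>

definition central4 :: "(nat \<Rightarrow> real) \<Rightarrow> real \<Rightarrow> real" where
  "central4 m x = m 4 - 4 * m 3 * x + 6 * m 2 * x^2 - 4 * m 1 * x^3 + m 0 * x^4"

lemma hankel_nth [simp]:
  "hankel m $ 1 $ 1 = m 0" "hankel m $ 1 $ 2 = m 1" "hankel m $ 1 $ 3 = m 2"
  "hankel m $ 2 $ 1 = m 1" "hankel m $ 2 $ 2 = m 2" "hankel m $ 2 $ 3 = m 3"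
  "hankel m $ 3 $ 1 = m 2" "hankel m $ 3 $ 2 = m 3" "hankel m $ 3 $ 3 = m 4"
  by (simp_all add: hankel_def)

lemma hankel_adj_inverse:
  "hankel m ** hankel_adj m = hankel_det m *\<^sub>R mat 1"
  "hankel_adj m ** hankel m = hankel_det m *\<^sub>R mat 1"
  by (simp_all add: vec_eq_iff forall_3 matrix_matrix_mult_def sum_3 mat_def
      hankel_adj_def hankel_det_def power2_eq_square power3_eq_cube algebra_simps)

lemma matrix_inv_hankel:
  assumes "hankel_det m \<noteq> 0"
  shows "matrix_inv (hankel m) = (1 / hankel_det m) *\<^sub>R hankel_adj m"
proof -
  let ?B = "(1 / hankel_det m) *\<^sub>R hankel_adj m"
  have AB: "hankel m ** ?B = mat 1" "?B ** hankel m = mat 1"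
    using assms by (simp_all add: hankel_adj_inverse matrix_scalar_ac flip: scalar_matrix_assoc)
  \<comment> \<open>\<open>matrix_inv\<close> is a choice among two-sided inverses: the scaled
    adjugate shows that one exists, and uniqueness identifies it.\<close>
  then have "hankel m ** matrix_inv (hankel m) = mat 1 \<and> matrix_inv (hankel m) ** hankel m = mat 1"
    using someI[of "\<lambda>B. hankel m ** B = mat 1 \<and> B ** hankel m = mat 1" ?B]
    unfolding matrix_inv_def by blast
  then show ?thesis
    by (metis AB matrix_mul_assoc matrix_mul_lid matrix_mul_rid)
qed

text \<open>The Gram determinant of \<open>f_P x\<close> and \<open>g_P x\<close> under
  \<open>adj M\<close> is the form of \<open>adj (adj M) = det M * M\<close> at their cross product
  \<open>(x^2, -2 * x, 1)\<close>, and \<open>M\<close> takes the value \<open>central4 m x\<close>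
  there.\<close>

lemma speed_P_matrix_inv_hankel:
  assumes "0 < hankel_det m"
  shows "speed_P (matrix_inv (hankel m)) x
    = sqrt (hankel_det m * central4 m x) / (f_P x \<bullet> (hankel_adj m *v f_P x))"
proof -
  let ?D = "hankel_det m" and ?A = "hankel_adj m"
  have gram: "(f_P x \<bullet> (?A *v f_P x)) * (g_P x \<bullet> (?A *v g_P x)) - (f_P x \<bullet> (?A *v g_P x))^2
      = ?D * central4 m x"
    unfolding f_P_def g_P_def hankel_adj_def hankel_det_def central4_def
    by (simp add: inner_vec_def matrix_vector_mult_def sum_3) algebra
  have scale: "u \<bullet> (((1 / ?D) *\<^sub>R ?A) *v v) = (u \<bullet> (?A *v v)) / ?D" for u v
    by (simp add: scaleR_matrix_vector_assoc[symmetric])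
  have "(f_P x \<bullet> (?A *v f_P x)) / ?D * ((g_P x \<bullet> (?A *v g_P x)) / ?D) - ((f_P x \<bullet> (?A *v g_P x)) / ?D)^2
      = ?D * central4 m x / ?D^2"
    unfolding gram[symmetric] by (simp add: power_divide diff_divide_distrib power2_eq_square)
  then show ?thesis
    using assms unfolding speed_P_def matrix_inv_hankel[OF less_imp_neq[OF assms, symmetric]] scale
    by (simp add: real_sqrt_divide)
qed

lemma hankel_adj_quadratic_form:
  "f_P x \<bullet> (hankel_adj m *v f_P x) = (m 2 * m 4 - (m 3)^2) + 2 * (m 2 * m 3 - m 1 * m 4) * x
    + (m 0 * m 4 - (m 2)^2 + 2 * (m 1 * m 3 - (m 2)^2)) * x^2
    + 2 * (m 1 * m 2 - m 0 * m 3) * x^3 + (m 0 * m 2 - (m 1)^2) * x^4"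
  unfolding f_P_def hankel_adj_def
  by (simp add: inner_vec_def matrix_vector_mult_def sum_3) algebra

text \<open>If \<open>(3 - c, - d, 1 + c, d, 3 - c)\<close> are the moments of \<open>Y\<close>, then \<open>m\<close> consists of
  \<open>k\<close> times those of \<open>b + a Y\<close>.\<close>

definition normal_form :: "real \<Rightarrow> real \<Rightarrow> real \<Rightarrow> real \<Rightarrow> real \<Rightarrow> (nat \<Rightarrow> real) \<Rightarrow> bool" where
  "normal_form k a b c d m \<longleftrightarrow>
     m 0 = k * (3 - c) \<and>
     m 1 = k * (b * (3 - c) - a * d) \<and>
     m 2 = k * (a^2 * (1 + c) - 2 * a * b * d + b^2 * (3 - c)) \<and>
     m 3 = k * (a^3 * d + 3 * a^2 * b * (1 + c) - 3 * a * b^2 * d + b^3 * (3 - c)) \<and>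
     m 4 = k * (a^4 * (3 - c) + 4 * a^3 * b * d + 6 * a^2 * b^2 * (1 + c) - 4 * a * b^3 * d
       + b^4 * (3 - c))"

text \<open>All three are homogeneous in the moments and covariant under affine substitution, whence
  the powers of \<open>k\<close> and \<open>a\<close>. Multiplying \<open>cos2\<close> and
  \<open>sin2\<close> by \<open>(1 + y^2)^2\<close> turns the rest into polynomial
  identities.\<close>

lemma normal_form_invariants:
  assumes "normal_form k a b c d m"
  shows "hankel_det m = k^3 * a^6 * (8 * (1 - (c^2 + d^2)))"
    and "central4 m (b + a * y)
      = k * a^4 * ((1 + y^2)^2 * (3 - (c * cos2 y + d * sin2 y)))"
    and "f_P (b + a * y) \<bullet> (hankel_adj m *v f_P (b + a * y))
      = k^2 * a^6 * ((1 + y^2)^2 * (3 - (c^2 + d^2) + 2 * (c * cos2 y + d * sin2 y)))"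
proof -
  note m = assms[unfolded normal_form_def, THEN conjunct1]
    assms[unfolded normal_form_def, THEN conjunct2, THEN conjunct1]
    assms[unfolded normal_form_def, THEN conjunct2, THEN conjunct2, THEN conjunct1]
    assms[unfolded normal_form_def, THEN conjunct2, THEN conjunct2, THEN conjunct2, THEN conjunct1]
    assms[unfolded normal_form_def, THEN conjunct2, THEN conjunct2, THEN conjunct2, THEN conjunct2]
  have cos2: "(1 + y^2)^2 * cos2 y = (1 - y^2)^2 - 4 * y^2"
    and sin2: "(1 + y^2)^2 * sin2 y = 4 * y * (1 - y^2)"
    using one_plus_square_pos[of y] by (simp_all add: cos2_def sin2_def)
  show "hankel_det m = k^3 * a^6 * (8 * (1 - (c^2 + d^2)))"
    unfolding hankel_det_def m by algebra
  have "central4 m (b + a * y) = k * a^4 * (3 * (1 + y^2)^2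
      - (c * ((1 - y^2)^2 - 4 * y^2) + d * (4 * y * (1 - y^2))))"
    unfolding central4_def m by algebra
  then show "central4 m (b + a * y)
      = k * a^4 * ((1 + y^2)^2 * (3 - (c * cos2 y + d * sin2 y)))"
    unfolding cos2[symmetric] sin2[symmetric] by (simp add: algebra_simps)
  have "f_P (b + a * y) \<bullet> (hankel_adj m *v f_P (b + a * y))
      = k^2 * a^6 * ((3 - (c^2 + d^2)) * (1 + y^2)^2
        + 2 * (c * ((1 - y^2)^2 - 4 * y^2) + d * (4 * y * (1 - y^2))))"
    unfolding hankel_adj_quadratic_form m by algebra
  then show "f_P (b + a * y) \<bullet> (hankel_adj m *v f_P (b + a * y))
      = k^2 * a^6 * ((1 + y^2)^2 * (3 - (c^2 + d^2) + 2 * (c * cos2 y + d * sin2 y)))"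
    unfolding cos2[symmetric] sin2[symmetric] by (simp add: algebra_simps)
qed

text \<open>The substitution \<open>x = b + a * y\<close> contributes a factor \<open>a\<close>. The
  numerator carries \<open>k^2 * a^5\<close> and the denominator \<open>k^2 * a^6\<close>, so
  \<open>k\<close> and \<open>a\<close> cancel altogether.\<close>

lemma Vol1_normal_form:
  assumes m: "normal_form k a b c d m" and "0 < k" "0 < a" "c^2 + d^2 < 1"
  shows "Vol1 (matrix_inv (hankel m)) = 2 * (LINT x|lborel. speed_normal c d x)"
proof -
  have D: "0 < hankel_det m"
    using assms by (simp add: normal_form_invariants(1)[OF m])
  have "a * speed_P (matrix_inv (hankel m)) (b + a * y) = speed_normal c d y" for y
  proof -
    define w where "w = 1 + y^2"
    define A where "A = 8 * (1 - (c^2 + d^2))"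
    define q where "q = 3 - (c * cos2 y + d * sin2 y)"
    define g where "g = 3 - (c^2 + d^2) + 2 * (c * cos2 y + d * sin2 y)"
    have pos: "0 < w" "0 < g"
      using one_plus_square_pos cos2_sin2_weight_pos assms by (simp_all add: w_def g_def)
    have "hankel_det m * central4 m (b + a * y) = (k^2 * a^5 * w)^2 * (A * q)"
      unfolding normal_form_invariants[OF m] w_def[symmetric] A_def[symmetric] q_def[symmetric]
      by algebra
    then have "sqrt (hankel_det m * central4 m (b + a * y)) = k^2 * a^5 * w * (sqrt A * sqrt q)"
      using pos assms by (simp add: real_sqrt_mult)
    then show ?thesis
      unfolding speed_P_matrix_inv_hankel[OF D] normal_form_invariants(3)[OF m] speed_normal_def
        w_def[symmetric] A_def[symmetric] q_def[symmetric] g_def[symmetric]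
      using pos assms by (simp add: field_simps eval_nat_numeral)
  qed
  then have "(LINT y|lborel. a * speed_P (matrix_inv (hankel m)) (b + a * y))
      = (LINT y|lborel. speed_normal c d y)"
    by simp
  then have "(LINT x|lborel. speed_P (matrix_inv (hankel m)) x) = (LINT x|lborel. speed_normal c d x)"
    using lborel_integral_real_affine[of a "speed_P (matrix_inv (hankel m))" b] assms by simp
  then show ?thesis by (simp add: Vol1_def)
qed

lemma Vol1_normal_form_ge:
  assumes "normal_form k a b c d m" "0 < k" "0 < a" "c^2 + d^2 < 1"
  shows "2 * pi * sqrt (8 / 3) \<le> Vol1 (matrix_inv (hankel m))"
    and "Vol1 (matrix_inv (hankel m)) = 2 * pi * sqrt (8 / 3) \<longleftrightarrow> c = 0 \<and> d = 0"
  using Vol1_normal_form[OF assms] integral_speed_normal_gt[OF assms(4)] integral_speed_normal_0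
  by (cases "c = 0 \<and> d = 0"; force)+

text \<open>Matches the equality case \<open>c = d = 0\<close> with the matrices of the theorem:
  \<open>q = a\<close>, \<open>r = b\<close>, and the scalar factor is \<open>3 * k\<close>.\<close>

lemma normal_form_0_iff:
  "normal_form k a b 0 0 m \<longleftrightarrow> hankel m = (3 * k) *\<^sub>R vector [
     vector [1, b, a^2 / 3 + b^2],
     vector [b, a^2 / 3 + b^2, b * (a^2 + b^2)],
     vector [a^2 / 3 + b^2, b * (a^2 + b^2), (a^2 + b^2)^2]]"
proof -
  have eqs:
    "k * (b * (3 - 0) - a * 0) = 3 * k * b"
    "k * (a^2 * (1 + 0) - 2 * a * b * 0 + b^2 * (3 - 0)) = 3 * k * (a^2 / 3 + b^2)"
    "k * (a^3 * 0 + 3 * a^2 * b * (1 + 0) - 3 * a * b^2 * 0 + b^3 * (3 - 0))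
      = 3 * k * (b * (a^2 + b^2))"
    "k * (a^4 * (3 - 0) + 4 * a^3 * b * 0 + 6 * a^2 * b^2 * (1 + 0) - 4 * a * b^3 * 0
      + b^4 * (3 - 0)) = 3 * k * (a^2 + b^2)^2"
    by algebra+
  show ?thesis
    unfolding normal_form_def eqs
    by (simp only: vec_eq_iff forall_3 hankel_nth vector_scaleR_component vector_3
        real_scaleR_def) auto
qed

section \<open>Reduction of positive definite Hankel matrices to normal form\<close>

lemma pos_def_hankel_pos:
  assumes "pos_def_matrix (hankel m)"
  shows "0 < m 0" "0 < m 0 * m 2 - (m 1)^2" "0 < hankel_det m" "0 < m 2 - 2 * m 1 * b + m 0 * b^2"
    "0 < central4 m b"
proof -
  have form: "0 < m 0 * x^2 + 2 * m 1 * x * y + m 2 * (y^2 + 2 * x * z) + 2 * m 3 * y * z + m 4 * z^2"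
    if "x \<noteq> 0 \<or> y \<noteq> 0 \<or> z \<noteq> 0" for x y z
  proof -
    have "(vector [x, y, z] :: real^3) \<noteq> 0"
      using that by (auto simp: vec_eq_iff forall_3)
    then have "0 < vector [x, y, z] \<bullet> (hankel m *v vector [x, y, z])"
      using assms by (simp add: pos_def_matrix_def)
    then show ?thesis
      by (simp add: inner_vec_def matrix_vector_mult_def sum_3 algebra_simps power2_eq_square)
  qed
  show m0: "0 < m 0" using form[of 1 0 0] by simp
  have "0 < m 0 * (m 0 * m 2 - (m 1)^2)"
    using form[of "- m 1" "m 0" 0] m0 by (simp add: algebra_simps power2_eq_square)
  with m0 show minor: "0 < m 0 * m 2 - (m 1)^2" by (simp add: zero_less_mult_iff)
  \<comment> \<open>The test vector is the third column of the adjugate, which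
    \<open>hankel m\<close> maps to \<open>hankel_det m\<close> times the third unit vector.\<close>
  have "0 < (m 0 * m 2 - (m 1)^2) * hankel_det m"
    using form[of "m 1 * m 3 - (m 2)^2" "m 1 * m 2 - m 0 * m 3" "m 0 * m 2 - (m 1)^2"] minor
    unfolding hankel_det_def by (simp add: algebra_simps power2_eq_square power3_eq_cube)
  with minor show "0 < hankel_det m" by (simp add: zero_less_mult_iff)
  show "0 < m 2 - 2 * m 1 * b + m 0 * b^2"
    using form[of "- b" 1 0] by (simp add: algebra_simps)
  \<comment> \<open>The test vector lists the coefficients of \<open>(x - b)^2\<close>; in the
    previous case it was \<open>x - b\<close>.\<close>
  show "0 < central4 m b"
    using form[of "b^2" "- 2 * b" 1] unfolding central4_def
    by (simp add: algebra_simps power2_eq_square power3_eq_cube power4_eq_xxxx)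
qed

text \<open>Divided by \<open>(1 + y^2)^2\<close>, the quartic \<open>central4\<close> is a
  trigonometric polynomial of degree 2 in \<theta>. Normal form means that its terms in
  \<open>cos \<theta>\<close> and \<open>sin \<theta>\<close> vanish: equal zeroth and fourth
  moments, opposite first and third.\<close>

lemma pos_def_hankel_normal_form:
  assumes "pos_def_matrix (hankel m)"
  obtains k a b c d where "normal_form k a b c d m" "0 < k" "0 < a" "c^2 + d^2 < 1"
proof -
  note pos = pos_def_hankel_pos[OF assms]
  define \<mu> where "\<mu> b = m 1 - m 0 * b" for b
  \<comment> \<open>\<open>\<mu> b\<close> and \<open>\<tau> b\<close> are the first and third
    moments about \<open>b\<close>.\<close>
  define \<tau> where "\<tau> b = m 3 - 3 * m 2 * b + 3 * m 1 * b^2 - m 0 * b^3" for b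
  txt \<open>At a zero \<open>b\<close> of \<open>h\<close>, the scale \<open>a\<close> that equates the zeroth and fourth moments of \<open>(X - b) / a\<close>
    also makes the first and third opposite.\<close>
  define h where "h b = \<tau> b + sqrt (central4 m b / m 0) * \<mu> b" for b
  have cont: "continuous_on S h" for S
    unfolding h_def \<tau>_def \<mu>_def central4_def using pos(1) by (intro continuous_intros) auto
  \<comment> \<open>\<open>\<tau>\<close> and \<open>\<mu>\<close> have the same sign near each end,
    so the sign change of \<open>h\<close> needs no estimate of the nonnegative square root.\<close>
  have "filterlim \<tau> at_bot at_top" "filterlim \<mu> at_bot at_top"
    unfolding \<tau>_def[abs_def] \<mu>_def[abs_def] using pos(1) by real_asymp+
  then have "eventually (\<lambda>x. \<tau> x \<le> 0 \<and> \<mu> x \<le> 0 \<and> 0 \<le> x) at_top"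
    unfolding filterlim_at_bot by (intro eventually_conj eventually_ge_at_top) blast+
  then obtain x where x: "\<tau> x \<le> 0" "\<mu> x \<le> 0" "0 \<le> x"
    using eventually_happens trivial_limit_at_top_linorder by blast
  have "filterlim \<tau> at_top at_bot" "filterlim \<mu> at_top at_bot"
    unfolding \<tau>_def[abs_def] \<mu>_def[abs_def] using pos(1) by real_asymp+
  then have "eventually (\<lambda>y. 0 \<le> \<tau> y \<and> 0 \<le> \<mu> y \<and> y \<le> 0) at_bot"
    unfolding filterlim_at_top by (intro eventually_conj eventually_le_at_bot) blast+
  then obtain y where y: "0 \<le> \<tau> y" "0 \<le> \<mu> y" "y \<le> 0"
    using eventually_happens trivial_limit_at_bot_linorder by blast
  have nn: "0 \<le> sqrt (central4 m b / m 0)" for b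
    using pos(1) pos(5)[of b] by simp
  have "h x \<le> 0" "0 \<le> h y"
    using x y nn[of x] nn[of y] unfolding h_def
    by (auto intro!: add_nonpos_nonpos mult_nonneg_nonpos add_nonneg_nonneg mult_nonneg_nonneg)
  then obtain b where b: "h b = 0"
    using IVT2'[of h x 0 y, OF _ _ _ cont] x y by auto
  define r where "r = sqrt (central4 m b / m 0)"
  define a where "a = sqrt r"
  have r: "0 < r" "central4 m b = r^2 * m 0"
    using pos(1) pos(5)[of b] by (auto simp: r_def)
  have a: "0 < a" "a^2 = r" using r by (auto simp: a_def)
  define \<sigma> where "\<sigma> = m 2 - 2 * m 1 * b + m 0 * b^2"
  have \<sigma>: "0 < \<sigma>" using pos(4) by (simp add: \<sigma>_def)
  \<comment> \<open>In normal form the zeroth and second moments are \<open>k * (3 - c)\<close> and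
    \<open>k * (1 + c)\<close>, with sum \<open>4 * k\<close>.\<close>
  define k where "k = (m 0 + \<sigma> / a^2) / 4"
  have k: "0 < k" using pos(1) \<sigma> a r by (simp add: k_def add_pos_pos)
  define c where "c = \<sigma> / (a^2 * k) - 1"
  define d where "d = - \<mu> b / (a * k)"
  have 0: "m 0 = k * (3 - c)"
  proof -
    have "k * (1 + c) = \<sigma> / a^2" using k a(1) by (simp add: c_def)
    moreover have "4 * k = m 0 + \<sigma> / a^2" by (simp add: k_def)
    ultimately show ?thesis by (simp add: algebra_simps)
  qed
  have 1: "\<mu> b = - (k * a * d)" using k a(1) by (simp add: d_def)
  have 2: "\<sigma> = k * a^2 * (1 + c)" using k a(1) by (simp add: c_def)
  \<comment> \<open>\<open>h b = 0\<close> reads \<open>\<tau> b = - a^2 * \<mu> b\<close>.\<close>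
  have 3: "\<tau> b = k * a^3 * d"
    using b 1 unfolding h_def r_def[symmetric] a(2)[symmetric] by algebra
  have 4: "central4 m b = k * a^4 * (3 - c)"
    unfolding r(2) 0 a(2)[symmetric] by algebra
  have m1: "m 1 = k * (b * (3 - c) - a * d)" (is "_ = ?Rm1")
  proof -
    have "m 1 = \<mu> b + m 0 * b" by (simp add: \<mu>_def)
    also have "\<dots> = ?Rm1" unfolding 1 0 by algebra
    finally show ?thesis .
  qed
  have m2: "m 2 = k * (a^2 * (1 + c) - 2 * a * b * d + b^2 * (3 - c))" (is "_ = ?Rm2")
  proof -
    have "m 2 = \<sigma> + 2 * m 1 * b - m 0 * b^2" by (simp add: \<sigma>_def)
    also have "\<dots> = ?Rm2" unfolding 2 m1 0 by algebra
    finally show ?thesis .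
  qed
  have m3: "m 3 = k * (a^3 * d + 3 * a^2 * b * (1 + c) - 3 * a * b^2 * d + b^3 * (3 - c))" (is "_ = ?Rm3")
  proof -
    have "m 3 = \<tau> b + 3 * m 2 * b - 3 * m 1 * b^2 + m 0 * b^3" by (simp add: \<tau>_def)
    also have "\<dots> = ?Rm3" unfolding 3 m2 m1 0 by algebra
    finally show ?thesis .
  qed
  have m4: "m 4 = k * (a^4 * (3 - c) + 4 * a^3 * b * d + 6 * a^2 * b^2 * (1 + c) - 4 * a * b^3 * d
       + b^4 * (3 - c))" (is "_ = ?Rm4")
  proof -
    have "m 4 = central4 m b + 4 * m 3 * b - 6 * m 2 * b^2 + 4 * m 1 * b^3 - m 0 * b^4" by (simp add: central4_def)
    also have "\<dots> = ?Rm4" unfolding 4 m3 m2 m1 0 by algebra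
    finally show ?thesis .
  qed
  have nf: "normal_form k a b c d m"
    unfolding normal_form_def using 0 m1 m2 m3 m4 by blast
  have "0 < k^3 * a^6 * (8 * (1 - (c^2 + d^2)))"
    using pos(3) normal_form_invariants(1)[OF nf] by simp
  moreover have "0 < k^3 * a^6" using k a(1) by simp
  ultimately have "c^2 + d^2 < 1"
    using zero_less_mult_pos by fastforce
  with nf k a(1) show ?thesis by (rule that)
qed

section \<open>The minimum\<close>

text \<open>Taking an entry is bounded linear, so each entry is an integral of \<open>x^n\<close>
  with \<open>n\<close> determined by the sum of the indices.\<close>

lemma M_P_hankel:
  assumes "M \<in> M_P"
  obtains m where "M = hankel m" "pos_def_matrix (hankel m)"
proof -
  obtain \<rho> where \<rho>: "pos_def_matrix M" "integrable \<rho> (\<lambda>x. outer_product (f_P x) (f_P x))"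
    "M = (LINT x|\<rho>. outer_product (f_P x) (f_P x))"
    using assms by (auto simp: M_P_def)
  have entry: "M $ i $ j = (LINT x|\<rho>. f_P x $ i * f_P x $ j)" for i j
  proof -
    have "bounded_linear (\<lambda>A :: real^3^3. A $ i $ j)"
      by (intro bounded_linear_compose[OF bounded_linear_vec_nth] bounded_linear_vec_nth)
    from integral_bounded_linear[OF this \<rho>(2)] show ?thesis
      by (simp add: \<rho>(3) outer_product_def)
  qed
  define m where "m n = [M $ 1 $ 1, M $ 1 $ 2, M $ 1 $ 3, M $ 2 $ 3, M $ 3 $ 3] ! n" for n
  have "M = hankel m"
    by (simp add: vec_eq_iff forall_3 m_def eval_nat_numeral)
      (simp add: entry f_P_def mult.commute power2_eq_square)
  with \<rho>(1) that show ?thesis by blast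
qed

text \<open>Serves to show that the lower bound for the volume is attained in \<open>M_P\<close>:
  these moments are in normal form with \<open>k = 6\<close>, \<open>a^2 = 1 / 3\<close> and
  \<open>b = c = d = 0\<close>.\<close>

lemma hankel_witness_in_M_P: "hankel (\<lambda>n. [18, 0, 2, 0, 2] ! n) \<in> M_P"
proof -
  define H where "H = hankel (\<lambda>n. [18, 0, 2, 0, 2] ! n)"
  have H: "H $ 1 $ 1 = 18" "H $ 1 $ 2 = 0" "H $ 1 $ 3 = 2" "H $ 2 $ 1 = 0" "H $ 2 $ 2 = 2"
    "H $ 2 $ 3 = 0" "H $ 3 $ 1 = 2" "H $ 3 $ 2 = 0" "H $ 3 $ 3 = 2"
    by (simp_all add: H_def eval_nat_numeral)
  have "0 < v \<bullet> (H *v v)" if "v \<noteq> 0" for v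
  proof -
    have "v \<bullet> (H *v v) = 16 * (v $ 1)^2 + 2 * (v $ 1 + v $ 3)^2 + 2 * (v $ 2)^2"
      by (simp add: inner_vec_def matrix_vector_mult_def sum_3 H algebra_simps power2_eq_square)
    moreover have "v $ 1 \<noteq> 0 \<or> v $ 2 \<noteq> 0 \<or> v $ 1 + v $ 3 \<noteq> 0"
      using that by (auto simp: vec_eq_iff forall_3)
    ultimately show ?thesis
      by (smt (verit) zero_le_power2 zero_less_power2)
  qed
  then have pd: "pos_def_matrix H"
    by (simp add: pos_def_matrix_def vec_eq_iff forall_3 transpose_def H)
  \<comment> \<open>Masses 16, 1, 1 at the points 0, 1, -1 have the moments 18, 0, 2, 0, 2.\<close>
  define w :: "real \<Rightarrow> real" where "w x = (if x = 0 then 16 else 1)" for x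
  define \<pi> where "\<pi> = point_measure {0, 1, -1} w"
  \<comment> \<open>The sigma-algebra of \<open>\<pi>\<close> is the power set of its three points;
    the image measure lives on the Borel sets, as \<open>M_P\<close> demands.\<close>
  define \<rho> where "\<rho> = distr \<pi> borel (\<lambda>x. x)"
  have meas: "(\<lambda>x. x) \<in> measurable \<pi> borel"
    by (simp add: \<pi>_def measurable_point_measure_eq1)
  have fm: "finite_measure \<pi>"
    unfolding \<pi>_def by (rule finite_measureI) (simp add: emeasure_point_measure_finite space_point_measure)
  have cont: "continuous_on UNIV (\<lambda>x. outer_product (f_P x) (f_P x))"
    unfolding outer_product_def using has_vector_derivative_continuous[OF f_P_has_vector_derivative]
    by (intro continuous_on_vec_lambda continuous_intros)
      (simp_all add: continuous_on_eq_continuous_at)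
  have "H = (LINT x|\<pi>. outer_product (f_P x) (f_P x))"
    unfolding \<pi>_def
    by (subst lebesgue_integral_point_measure_finite)
      (simp_all add: w_def vec_eq_iff forall_3 H outer_product_def f_P_def)
  moreover have "integrable \<pi> (\<lambda>x. outer_product (f_P x) (f_P x))"
    unfolding \<pi>_def by (rule integrable_point_measure_finite) simp
  ultimately have "H = (LINT x|\<rho>. outer_product (f_P x) (f_P x))"
    "integrable \<rho> (\<lambda>x. outer_product (f_P x) (f_P x))"
    unfolding \<rho>_def
    by (simp_all add: integral_distr[OF meas borel_measurable_continuous_onI[OF cont]]
        integrable_distr_eq[OF meas borel_measurable_continuous_onI[OF cont]])
  moreover have "finite_measure \<rho>" "sets \<rho> = sets borel"
    using finite_measure.finite_measure_distr[OF fm meas] by (simp_all add: \<rho>_def)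
  ultimately show ?thesis
    using pd by (auto simp: M_P_def H_def)
qed

theorem theorem4p7:
  fixes M :: "real^3^3"
  assumes "M \<in> M_P"
  shows "is_arg_min (\<lambda>N. Vol1 (matrix_inv N)) (\<lambda>N. N \<in> M_P) M \<longleftrightarrow>
    (\<exists>q r k :: real. q \<noteq> 0 \<and> k > 0 \<and>
       M = k *\<^sub>R vector [
         vector [1,             r,                 q^2/3 + r^2],
         vector [r,             q^2/3 + r^2,       r * (q^2 + r^2)],
         vector [q^2/3 + r^2,   r * (q^2 + r^2),   (q^2 + r^2)^2]])"
    (is "?min \<longleftrightarrow> ?form")
proof -
  let ?V = "\<lambda>N. Vol1 (matrix_inv N)"
  let ?v = "2 * pi * sqrt (8 / 3)"
  have lower: "?v \<le> ?V N" if "N \<in> M_P" for N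
    using that Vol1_normal_form_ge(1) by (metis M_P_hankel pos_def_hankel_normal_form)
  let ?W = "hankel (\<lambda>n. [18, 0, 2, 0, 2] ! n)"
  have "normal_form 6 (sqrt (1 / 3)) 0 0 0 (\<lambda>n. [18, 0, 2, 0, 2] ! n)"
    by (simp add: normal_form_def eval_nat_numeral)
  then have W: "?V ?W = ?v"
    using Vol1_normal_form_ge(2) by fastforce
  \<comment> \<open>The bound is attained at the witness, so minimizing means having exactly this
    volume.\<close>
  have "?min \<longleftrightarrow> ?V M = ?v"
    using assms lower hankel_witness_in_M_P W unfolding is_arg_min_linorder
    by (metis order_antisym)
  also have "\<dots> \<longleftrightarrow> ?form"
  proof
    assume V: "?V M = ?v"
    obtain m where m: "M = hankel m" "pos_def_matrix (hankel m)"
      using M_P_hankel[OF assms] by blast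
    obtain k a b c d where nf: "normal_form k a b c d m" "0 < k" "0 < a" "c^2 + d^2 < 1"
      using pos_def_hankel_normal_form[OF m(2)] by blast
    have "c = 0 \<and> d = 0"
      using Vol1_normal_form_ge(2)[OF nf] V m(1) by simp
    then have "normal_form k a b 0 0 m" using nf(1) by simp
    then show ?form
      using nf(2,3) unfolding normal_form_0_iff m(1)[symmetric]
      by (intro exI[of _ a] exI[of _ b] exI[of _ "3 * k"]) simp
  next
    assume ?form
    then obtain q r k where qrk: "q \<noteq> 0" "0 < k" "M = k *\<^sub>R vector [
         vector [1,             r,                 q^2/3 + r^2],
         vector [r,             q^2/3 + r^2,       r * (q^2 + r^2)],
         vector [q^2/3 + r^2,   r * (q^2 + r^2),   (q^2 + r^2)^2]]"
      by blast
    obtain m where m: "M = hankel m"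
      using M_P_hankel[OF assms] by blast
    \<comment> \<open>The scale must be positive for the volume formula, and the matrix depends on
      \<open>q\<close> only through \<open>q^2\<close>.\<close>
    have "normal_form (k / 3) \<bar>q\<bar> r 0 0 m"
      unfolding normal_form_0_iff using m qrk(3) by simp
    from Vol1_normal_form_ge(2)[OF this] show "?V M = ?v"
      using qrk m by simp
  qed
  finally show ?thesis .
qed

end
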